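(* Let $t\ge2$ and $m\ge 2$ be integers, let $M=\{0,1,\dots,m-1\}$, and let $B=\{a\in M^t:\ \sum_{i=1}^t a_i=\lfloor (m-1)t/2\rfloor\}$. Then in the setting of directed graphs, $\hat R_t(P_{m+1})\ge\binom{|B|+1}{2}$.
   Context: Here $P_{m+1}$ is the directed path with $m+1$ vertices and $m$ edges. In the setting of directed graphs, $\hat R_t(P_{m+1})$ is the minimum number of edges of a directed graph $D$ (arbitrary digraphs allowed, including both orientations of a pair) such that every coloring of the edges of $D$ with $t$ colors contains a monochromatic directed path with $m$ edges. *)

theory Defs
  imports "Graph_Theory.Graph_Theory" "HOL-Library.FuncSet"
begin

definition forces_mono_dipath :: "('a, 'b) pre_digraph \<Rightarrow> nat \<Rightarrow> nat \<Rightarrow> bool" where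
  "forces_mono_dipath D t m \<longleftrightarrow>
     (\<forall>\<chi> \<in> arcs D \<rightarrow> {1..t}.
        \<exists>i u p v. pre_digraph.apath D u p v \<and> length p = m \<and> (\<forall>e \<in> set p. \<chi> e = i))"

text \<open>
  The second argument \<open>m\<close> is the number of edges of the path, so that
  \<open>dipath_size_ramsey t m\<close> is the \<open>t\<close>-colour size Ramsey number of the directed path on
  \<open>m + 1\<close> vertices. Every finite digraph is isomorphic to one with vertices in \<open>nat\<close>. The
  minimum is over a nonempty set if \<open>m \<ge> 1\<close>: the transitive tournament on \<open>m ^ t + 1\<close>
  vertices forces a monochromatic path (map each vertex to the vector of the lengths of the
  longest monochromatic paths ending there; this map is injective).
\<close>

definition dipath_size_ramsey :: "nat \<Rightarrow> nat \<Rightarrow> nat" where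
  "dipath_size_ramsey t m =
     (LEAST k. \<exists>D :: nat pair_pre_digraph.
        digraph (with_proj D) \<and> card (parcs D) = k \<and> forces_mono_dipath (with_proj D) t m)"

end

theory Submission
  imports Defs
begin

text \<open>
  The vectors in \<open>B\<close> have equal coordinate sums, so distinct \<open>a, b \<in> B\<close> satisfy \<open>a i < b i\<close> for
  some \<open>i\<close>. If the vertices of \<open>D\<close> are properly coloured by elements of \<open>B\<close>, colour each
  arc by a coordinate that increases along it: this coordinate takes values in \<open>{0..m - 1}\<close>, so no
  monochromatic path has \<open>m\<close> arcs. Hence a digraph that forces such a path has chromatic number
  greater than \<open>card B\<close>, and in an optimal colouring any two colour classes are joined by an arc.
\<close>

text \<open>Each arc raises \<open>f\<close> by at least one, as the values are natural numbers.
  With \<open>f\<close> a coordinate of the vertex colours this bounds monochromatic paths; with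
  \<open>f\<close> the identity it shows that walks in a transitive tournament never
  descend.\<close>

lemma (in wf_digraph) awalk_length_le_potential:
  fixes f :: "'a \<Rightarrow> nat"
  assumes "awalk u p v" and "\<forall>e\<in>set p. f (tail G e) < f (head G e)"
  shows "f u + length p \<le> f v"
  using assms
proof (induction p arbitrary: u)
  case Nil
  then show ?case by (simp add: awalk_Nil_iff)
next
  case (Cons e p)
  then have "f (head G e) + length p \<le> f v" "u = tail G e" by (auto simp: awalk_Cons_iff)
  moreover have "f (tail G e) < f (head G e)" using Cons.prems by simp
  ultimately show ?case by simp
qed

lemma ex_proper_colouring:
  assumes "fin_digraph G" and "loopfree_digraph G" and "finite K"
    and few: "card (arcs G) < (card K + 1) choose 2"
  obtains c where "c \<in> verts G \<rightarrow> K" and "\<forall>e\<in>arcs G. c (tail G e) \<noteq> c (head G e)"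
proof -
  interpret fin_digraph G by fact
  interpret loopfree_digraph G by fact
  define proper where "proper c \<longleftrightarrow> (\<forall>e\<in>arcs G. c (tail G e) \<noteq> c (head G e))" for c :: "'a \<Rightarrow> 'a"
  \<comment> \<open>Colours are taken from the vertex type, so that the identity is a proper
    colouring from which to minimise the number of colours.\<close>
  have "proper id" unfolding proper_def using no_loops by simp
  then obtain c where c: "proper c"
    and least: "\<And>d. proper d \<Longrightarrow> card (c ` verts G) \<le> card (d ` verts G)"
    using ex_has_least_nat[of proper id "\<lambda>c. card (c ` verts G)"] by blast
  have joined: "\<exists>e\<in>arcs G. {c (tail G e), c (head G e)} = {x, y}"
    if xy: "x \<in> c ` verts G" "y \<in> c ` verts G" "x \<noteq> y" for x y
  proof (rule ccontr)
    assume contra: "\<not> ?thesis"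
    \<comment> \<open>Otherwise the classes \<open>x\<close> and \<open>y\<close> could be merged.\<close>
    define d where "d v = (if c v = y then x else c v)" for v
    have "proper d"
      unfolding proper_def
    proof
      fix e assume e: "e \<in> arcs G"
      then have "c (tail G e) \<noteq> c (head G e)" using c by (simp add: proper_def)
      moreover have "{c (tail G e), c (head G e)} \<noteq> {x, y}" using contra e by blast
      ultimately show "d (tail G e) \<noteq> d (head G e)" by (auto simp: d_def)
    qed
    moreover have "d ` verts G \<subseteq> c ` verts G - {y}" using xy by (auto simp: d_def)
    then have "card (d ` verts G) \<le> card (c ` verts G - {y})" by (intro card_mono) auto
    moreover have "card (c ` verts G - {y}) < card (c ` verts G)"
      using xy by (intro card_Diff1_less) auto
    ultimately show False using least[of d] by simp
  qed
  \<comment> \<open>Each arc accounts for one pair of colours only, so covering all pairs takes at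
    least as many arcs as there are pairs.\<close>
  have "{X. X \<subseteq> c ` verts G \<and> card X = 2} \<subseteq> (\<lambda>e. {c (tail G e), c (head G e)}) ` arcs G"
  proof
    fix X assume "X \<in> {X. X \<subseteq> c ` verts G \<and> card X = 2}"
    then obtain x y where "X = {x, y}" "x \<noteq> y" "x \<in> c ` verts G" "y \<in> c ` verts G"
      by (auto simp: card_2_iff)
    with joined[of x y] show "X \<in> (\<lambda>e. {c (tail G e), c (head G e)}) ` arcs G" by auto
  qed
  then have "card {X. X \<subseteq> c ` verts G \<and> card X = 2} \<le> card (arcs G)"
    by (rule surj_card_le[OF finite_arcs])
  then have "card (c ` verts G) choose 2 \<le> card (arcs G)" by (simp add: n_subsets)
  then have "card (c ` verts G) choose 2 < (card K + 1) choose 2" using few by simp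
  \<comment> \<open>\<open>n choose 2\<close> is monotone in \<open>n\<close>.\<close>
  then have "\<not> card K + 1 \<le> card (c ` verts G)"
    by (metis choose_two diff_le_mono div_le_mono mult_le_mono not_le)
  then have "card (c ` verts G) \<le> card K" by simp
  then obtain g where g: "g ` c ` verts G \<subseteq> K" "inj_on g (c ` verts G)"
    using card_le_inj[of "c ` verts G" K] \<open>finite K\<close> by auto
  show thesis
  proof (rule that)
    show "g \<circ> c \<in> verts G \<rightarrow> K" using g by auto
    show "\<forall>e\<in>arcs G. (g \<circ> c) (tail G e) \<noteq> (g \<circ> c) (head G e)"
      using c g(2) by (auto simp: proper_def inj_on_eq_iff)
  qed
qed

lemma eq_sum_imp_ex_less:
  fixes a b :: "'i \<Rightarrow> 'v :: {ordered_cancel_comm_monoid_add, linorder}"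
  assumes "finite I" and "sum a I = sum b I" and "\<exists>i\<in>I. a i \<noteq> b i"
  shows "\<exists>i\<in>I. a i < b i"
proof (rule ccontr)
  assume "\<not> ?thesis"
  then have "\<forall>i\<in>I. b i \<le> a i" "\<exists>i\<in>I. b i < a i"
    using assms(3) by (force simp: not_less)+
  then have "sum b I < sum a I" using sum_strict_mono_ex1[OF \<open>finite I\<close>] by blast
  with assms(2) show False by simp
qed

lemma not_forces_mono_dipath_if_coloured:
  assumes "wf_digraph G" and "m \<ge> 1"
    and c: "c \<in> verts G \<rightarrow> {a \<in> {1..t} \<rightarrow>\<^sub>E {0..m - 1}. (\<Sum>i=1..t. a i) = s}"
    and proper: "\<forall>e\<in>arcs G. c (tail G e) \<noteq> c (head G e)"
  shows "\<not> forces_mono_dipath G t m"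
proof
  assume forces: "forces_mono_dipath G t m"
  interpret wf_digraph G by fact
  have "\<exists>i\<in>{1..t}. c (tail G e) i < c (head G e) i" if e: "e \<in> arcs G" for e
  proof (rule eq_sum_imp_ex_less)
    have "tail G e \<in> verts G" "head G e \<in> verts G" using e by simp_all
    then have ends: "c (tail G e) \<in> {a \<in> {1..t} \<rightarrow>\<^sub>E {0..m - 1}. (\<Sum>i=1..t. a i) = s}"
      "c (head G e) \<in> {a \<in> {1..t} \<rightarrow>\<^sub>E {0..m - 1}. (\<Sum>i=1..t. a i) = s}"
      using c by blast+
    then show "(\<Sum>i=1..t. c (tail G e) i) = (\<Sum>i=1..t. c (head G e) i)" by simp
    show "\<exists>i\<in>{1..t}. c (tail G e) i \<noteq> c (head G e) i"
    \<comment> \<open>Colours are extensional functions, so agreement on \<open>{1..t}\<close> would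
      make the two end colours equal.\<close>
    proof (rule ccontr)
      assume "\<not> ?thesis"
      then have "c (tail G e) = c (head G e)" using ends by (intro PiE_ext) auto
      then show False using proper e by blast
    qed
  qed simp
  then obtain \<chi> where \<chi>: "\<And>e. e \<in> arcs G \<Longrightarrow> \<chi> e \<in> {1..t} \<and> c (tail G e) (\<chi> e) < c (head G e) (\<chi> e)"
    by metis
  then have "\<chi> \<in> arcs G \<rightarrow> {1..t}" by blast
  then obtain i u p v where p: "apath u p v" "length p = m" "\<forall>e\<in>set p. \<chi> e = i"
    using forces unfolding forces_mono_dipath_def by blast
  then have walk: "awalk u p v" and arcs: "set p \<subseteq> arcs G" by (auto dest: awalkI_apath)
  have "\<forall>e\<in>set p. c (tail G e) i < c (head G e) i"
  proof
    fix e assume "e \<in> set p"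
    then have "e \<in> arcs G" "\<chi> e = i" using arcs p(3) by auto
    then show "c (tail G e) i < c (head G e) i" using \<chi>[of e] by simp
  qed
  then have le: "c u i + length p \<le> c v i"
    using awalk_length_le_potential[OF walk, of "\<lambda>v. c v i"] by blast
  \<comment> \<open>\<open>forces_mono_dipath\<close> does not restrict \<open>i\<close> to
    \<open>{1..t}\<close>; the first arc of \<open>p\<close> shows that it is an actual
    colour.\<close>
  have "p \<noteq> []" using p(2) \<open>m \<ge> 1\<close> by auto
  then have "i \<in> {1..t}" using \<chi>[of "hd p"] p(3) arcs by (metis hd_in_set subsetD)
  moreover have "c v \<in> {1..t} \<rightarrow>\<^sub>E {0..m - 1}"
    using funcset_mem[OF c awalk_last_in_verts[OF walk]] by simp
  ultimately have "c v i \<le> m - 1" by (meson PiE_mem atLeastAtMost_iff)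
  then show False using le p(2) \<open>m \<ge> 1\<close> by simp
qed

text \<open>These tournaments serve as witnesses that the \<open>LEAST\<close> in
  \<open>dipath_size_ramsey\<close> is attained.\<close>

lemma digraph_transitive_tournament:
  "digraph (with_proj \<lparr>pverts = {..<n::nat}, parcs = {(u, v). u < v \<and> v < n}\<rparr>)"
proof -
  have "finite {(u, v). u < v \<and> v < n}"
    by (rule finite_subset[of _ "{..<n} \<times> {..<n}"]) auto
  then show ?thesis by unfold_locales (auto simp: arc_to_ends_def)
qed

text \<open>
  Send a vertex to the vector of the lengths of the longest monochromatic paths starting there.
  Without a monochromatic path with \<open>m\<close> arcs, this is an injection into \<open>{0..m - 1} ^ t\<close>.
\<close>

lemma transitive_tournament_forces_mono_dipath:
  assumes "n > m ^ t"
  shows "forces_mono_dipath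
     (with_proj \<lparr>pverts = {..<n}, parcs = {(u, v). u < v \<and> v < n}\<rparr>) t m"
    (is "forces_mono_dipath ?D t m")
  unfolding forces_mono_dipath_def
proof (rule ballI, rule ccontr)
  interpret digraph ?D by (rule digraph_transitive_tournament)
  fix \<chi> assume \<chi>: "\<chi> \<in> arcs ?D \<rightarrow> {1..t}"
  assume none: "\<not> (\<exists>i u p v. apath u p v \<and> length p = m \<and> (\<forall>e\<in>set p. \<chi> e = i))"
  \<comment> \<open>\<open>none\<close> excludes length exactly \<open>m\<close>; a longer path
    would have a suffix with \<open>m\<close> arcs.\<close>
  have short: "length p < m" if p: "apath u p v" "\<forall>e\<in>set p. \<chi> e = i" for i u p v
  proof (rule ccontr)
    assume "\<not> length p < m"
    define k where "k = length p - m"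
    have "apath (awlast u (take k p)) (drop k p) v"
      using p(1) apath_append_iff[of u "take k p" "drop k p" v] by simp
    moreover have "length (drop k p) = m" using \<open>\<not> length p < m\<close> by (simp add: k_def)
    moreover have "\<forall>e\<in>set (drop k p). \<chi> e = i" using p(2) by (meson in_set_dropD)
    ultimately show False using none by blast
  qed
  define S where "S i u = {length p | p v. apath u p v \<and> (\<forall>e\<in>set p. \<chi> e = i)}" for i u
  have S_less: "S i u \<subseteq> {..<m}" for i u unfolding S_def using short by blast
  then have S_finite: "finite (S i u)" for i u by (rule finite_subset) simp
  \<comment> \<open>The empty path keeps \<open>S i u\<close> nonempty, so that its
    \<open>Max\<close> is attained.\<close>
  have S_zero: "0 \<in> S i u" if "u \<in> verts ?D" for i u
    unfolding S_def using that apath_Nil_iff[of u u] by force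
  have Max_S: "Max (S i u) \<in> S i u" if "u \<in> verts ?D" for i u
    using S_finite S_zero[OF that] by (metis Max_in empty_iff)
  have S_arc: "Max (S i v) < Max (S i u)"
    if uv: "(u, v) \<in> arcs ?D" and i: "\<chi> (u, v) = i" for i u v
  proof -
    have "v \<in> verts ?D" "u < v" using uv by auto
    then obtain p w where p: "apath v p w" "\<forall>e\<in>set p. \<chi> e = i" "Max (S i v) = length p"
      using Max_S[of v i] unfolding S_def by blast
    \<comment> \<open>All arcs go upwards, so a path from \<open>v\<close> avoids the smaller vertex
      \<open>u\<close> and stays a path when the arc \<open>(u, v)\<close> is put in front.\<close>
    have "v \<le> x" if "x \<in> set (awalk_verts v p)" for x
    proof -
      from awalk_decomp[OF awalkI_apath[OF p(1)] that]
      obtain q where q: "awalk v q x" by blast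
      then have "set q \<subseteq> arcs ?D" by blast
      then have "\<forall>e\<in>set q. id (tail ?D e) < id (head ?D e)" by auto
      then show ?thesis using awalk_length_le_potential[OF q, of id] by simp
    qed
    then have "u \<notin> set (awalk_verts v p)" using \<open>u < v\<close> by (meson not_le)
    then have "apath u ((u, v) # p) w"
      using uv p(1) by (simp add: apath_Cons_iff)
    then have "Suc (length p) \<in> S i u"
      unfolding S_def using p(2) i by force
    then show ?thesis using p(3) Max_ge[OF S_finite, of "Suc (length p)" i u] by simp
  qed
  \<comment> \<open>Restricting to \<open>{1..t}\<close> places \<open>L u\<close> in a function
    space with \<open>m ^ t\<close> elements.\<close>
  define L where "L u = restrict (\<lambda>i. Max (S i u)) {1..t}" for u
  have "inj_on L {..<n}"
  proof (rule linorder_inj_onI)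
    fix u v assume uv: "u < v" "u \<in> {..<n}" "v \<in> {..<n}"
    then have arc: "(u, v) \<in> arcs ?D" by simp
    then have "\<chi> (u, v) \<in> {1..t}" using \<chi> by blast
    then have "L v (\<chi> (u, v)) < L u (\<chi> (u, v))" using S_arc[OF arc refl] by (simp add: L_def)
    then show "L u \<noteq> L v" by auto
  qed auto
  moreover have "L ` {..<n} \<subseteq> {1..t} \<rightarrow>\<^sub>E {..<m}"
    using Max_S S_less by (fastforce simp: L_def)
  ultimately have "card {..<n} \<le> card ({1..t} \<rightarrow>\<^sub>E {..<m})"
    by (intro card_inj_on_le) (auto intro: finite_PiE)
  then show False using assms by (simp add: card_PiE)
qed

theorem theorem14:
  fixes t m :: nat and M :: "nat set" and B :: "(nat \<Rightarrow> nat) set"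
  assumes "t \<ge> 2" and "m \<ge> 2"
    and "M = {0..m - 1}"
    and "B = {a \<in> {1..t} \<rightarrow>\<^sub>E M. (\<Sum>i=1..t. a i) = (m - 1) * t div 2}"
  shows "dipath_size_ramsey t m \<ge> (card B + 1) choose 2"
proof -
  \<comment> \<open>The witness is the transitive tournament on \<open>Suc (m ^ t)\<close>
    vertices.\<close>
  have "\<exists>k. \<exists>D :: nat pair_pre_digraph.
      digraph (with_proj D) \<and> card (parcs D) = k \<and> forces_mono_dipath (with_proj D) t m"
    using digraph_transitive_tournament transitive_tournament_forces_mono_dipath[OF lessI] by blast
  then have "\<exists>D :: nat pair_pre_digraph. digraph (with_proj D) \<and>
      card (parcs D) = dipath_size_ramsey t m \<and> forces_mono_dipath (with_proj D) t m"
    unfolding dipath_size_ramsey_def by (rule LeastI_ex)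
  then obtain D :: "nat pair_pre_digraph" where D: "digraph (with_proj D)"
    "card (parcs D) = dipath_size_ramsey t m" "forces_mono_dipath (with_proj D) t m"
    by blast
  interpret digraph "with_proj D" by (rule D(1))
  have "B \<subseteq> {1..t} \<rightarrow>\<^sub>E M" "finite ({1..t} \<rightarrow>\<^sub>E M)"
    unfolding assms(3,4) by (blast, intro finite_PiE) auto
  then have "finite B" by (rule finite_subset)
  show ?thesis
  proof (rule ccontr)
    assume "\<not> ?thesis"
    then have "card (arcs (with_proj D)) < (card B + 1) choose 2" using D(2) by simp
    then obtain c where "c \<in> verts (with_proj D) \<rightarrow> B"
      "\<forall>e\<in>arcs (with_proj D). c (tail (with_proj D) e) \<noteq> c (head (with_proj D) e)"
      using ex_proper_colouring[OF fin_digraph_axioms loopfree_digraph_axioms \<open>finite B\<close>] by blast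
    then have "\<not> forces_mono_dipath (with_proj D) t m"
      using not_forces_mono_dipath_if_coloured[OF wf_digraph_axioms] assms by simp
    then show False using D(3) by contradiction
  qed
qed

end
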